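(* Let $L$ be a countable linear order such that either $L$ has no minimum or $L\setminus\{\min L\}$ has no minimum, and let $D\subseteq\mathbb{R}^+$ with $\inf D>0$ such that $2\cdot L$ embeds into $D$. Fix an order embedding of $2\cdot L$ into $D$ and let $\ell^-,\ell^+$ be the images of $(0,\ell),(1,\ell)$. For a pruned $L$-tree $\mathcal{T}=(T,\le_T,\lambda_T)$ let $\mathbf{G}(\mathcal{T})=(T,d_T)$ with $d_T(t_0,t_1)=0$ if $t_0=t_1$, $d_T(t_0,t_1)=\lambda_T(t_i)^-$ if $t_{1-i}<_Tt_i$, and $d_T(t_0,t_1)=\operatorname{spl}(t_0,t_1)^+$ if $t_0,t_1$ are $\le_T$-incomparable; and let $\mathbf{G}$ be the identity on arrows. Then $\mathbf{G}\colon\mathbf{T}_L^{\mathrm{pr}}\to\mathbf{U}^0_D$ is a categorical full embedding such that $\mathbf{G}(\mathcal{T})$ is uniformly discrete and $|\mathbf{G}(\mathcal{T})|=|\mathcal{T}|$ (hence $\operatorname{weight}(\mathbf{G}(\mathcal{T}))=|\mathcal{T}|$).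
   Context: $2\cdot L$ is the product of the two-element order $\{0<1\}$ and $L$ ordered antilexicographically, so $(0,\ell)<(1,\ell)<(0,\ell')$ for $\ell<\ell'$. An $L$-tree is $(T,\le_T,\lambda_T)$ with $(T,\le_T)$ a partial order and $\lambda_T\colon T\to L$ surjective such that for all $t,t'$: (1) $t<_Tt'\Rightarrow\lambda_T(t)<\lambda_T(t')$; (2) for each $\ell\ge\lambda_T(t)$ there is a unique $t|_\ell\ge_Tt$ with $\lambda_T(t|_\ell)=\ell$; (3) $t|_\ell=t'|_\ell$ for some $\ell\ge\max\{\lambda_T(t),\lambda_T(t')\}$; (4) for incomparable $t,t'$, the set $\{\ell\ge\max\{\lambda_T(t),\lambda_T(t')\}:t|_\ell\ne t'|_\ell\}$ has a maximum $\operatorname{spl}(t,t')$. Pruned: every $t$ equals $b(\lambda_T(t))$ for a branch $b\colon L\to T$ ($\lambda_T(b(\ell))=\ell$, $b$ monotone). $\mathbf{T}_L^{\mathrm{pr}}$: pruned $L$-trees with embeddings (level-preserving injections with $t\le t'\iff f(t)\le f(t')$). $\mathbf{U}^0_D$: discrete nonempty complete ultrametric spaces with nonzero distances in $D$, with isometric embeddings. Uniformly discrete: nonzero distances bounded below by a positive constant. Categorical full embedding: faithful full functor injective on objects. *)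

theory Defs
  imports "HOL-Analysis.Analysis"
begin

unbundle cardinal_syntax

section \<open>Categories and full embeddings\<close>

text \<open>Hom-sets are indexed by pairs of objects and need not be disjoint, so composition and
  the arrow part of a functor also take the objects involved as arguments.\<close>

record ('o, 'm) cat =
  Obj :: "'o set"
  Hom :: "'o \<Rightarrow> 'o \<Rightarrow> 'm set"
  Id :: "'o \<Rightarrow> 'm"
  Comp :: "'o \<Rightarrow> 'o \<Rightarrow> 'o \<Rightarrow> 'm \<Rightarrow> 'm \<Rightarrow> 'm"  \<comment> \<open>\<open>Comp C A B E g f\<close> is \<open>g\<close> after \<open>f\<close>,
    for \<open>f\<close> from \<open>A\<close> to \<open>B\<close> and \<open>g\<close> from \<open>B\<close> to \<open>E\<close>\<close>

locale category =
  fixes C :: "('o, 'm) cat"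
  assumes Id_in_Hom: "A \<in> Obj C \<Longrightarrow> Id C A \<in> Hom C A A"
    and Comp_in_Hom: "\<lbrakk>A \<in> Obj C; B \<in> Obj C; E \<in> Obj C; f \<in> Hom C A B; g \<in> Hom C B E\<rbrakk>
      \<Longrightarrow> Comp C A B E g f \<in> Hom C A E"
    and Comp_Id_right: "\<lbrakk>A \<in> Obj C; B \<in> Obj C; f \<in> Hom C A B\<rbrakk> \<Longrightarrow> Comp C A A B f (Id C A) = f"
    and Comp_Id_left: "\<lbrakk>A \<in> Obj C; B \<in> Obj C; f \<in> Hom C A B\<rbrakk> \<Longrightarrow> Comp C A B B (Id C B) f = f"
    and Comp_assoc: "\<lbrakk>A \<in> Obj C; B \<in> Obj C; E \<in> Obj C; F \<in> Obj C;
        f \<in> Hom C A B; g \<in> Hom C B E; h \<in> Hom C E F\<rbrakk>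
      \<Longrightarrow> Comp C A E F h (Comp C A B E g f) = Comp C A B F (Comp C B E F h g) f"

locale cat_functor = dom: category C + cod: category C'
  for C :: "('o, 'm) cat" and C' :: "('p, 'n) cat" +
  fixes Fo :: "'o \<Rightarrow> 'p" and Fa :: "'o \<Rightarrow> 'o \<Rightarrow> 'm \<Rightarrow> 'n"
  assumes Fo_Obj: "A \<in> Obj C \<Longrightarrow> Fo A \<in> Obj C'"
    and Fa_Hom: "\<lbrakk>A \<in> Obj C; B \<in> Obj C; f \<in> Hom C A B\<rbrakk> \<Longrightarrow> Fa A B f \<in> Hom C' (Fo A) (Fo B)"
    and Fa_Id: "A \<in> Obj C \<Longrightarrow> Fa A A (Id C A) = Id C' (Fo A)"
    and Fa_Comp: "\<lbrakk>A \<in> Obj C; B \<in> Obj C; E \<in> Obj C; f \<in> Hom C A B; g \<in> Hom C B E\<rbrakk>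
      \<Longrightarrow> Fa A E (Comp C A B E g f) = Comp C' (Fo A) (Fo B) (Fo E) (Fa B E g) (Fa A B f)"

locale cat_full_embedding = cat_functor C C' Fo Fa
  for C :: "('o, 'm) cat" and C' :: "('p, 'n) cat"
    and Fo :: "'o \<Rightarrow> 'p" and Fa :: "'o \<Rightarrow> 'o \<Rightarrow> 'm \<Rightarrow> 'n" +
  assumes faithful: "\<lbrakk>A \<in> Obj C; B \<in> Obj C\<rbrakk> \<Longrightarrow> inj_on (Fa A B) (Hom C A B)"
    and full: "\<lbrakk>A \<in> Obj C; B \<in> Obj C; g \<in> Hom C' (Fo A) (Fo B)\<rbrakk>
      \<Longrightarrow> \<exists>f \<in> Hom C A B. Fa A B f = g"
    and inj_Obj: "inj_on Fo (Obj C)"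


section \<open>Linear orders\<close>

definition has_min :: "'l::linorder set \<Rightarrow> bool" where
  "has_min S \<longleftrightarrow> (\<exists>m\<in>S. \<forall>x\<in>S. m \<le> x)"

text \<open>The order of \<open>2 \<cdot> L\<close>, with \<open>False\<close> and \<open>True\<close> in the roles of \<open>0\<close> and \<open>1\<close>; it
  compares second components first.\<close>

definition antilex_le :: "bool \<times> 'l::linorder \<Rightarrow> bool \<times> 'l \<Rightarrow> bool" where
  "antilex_le p q \<longleftrightarrow> snd p < snd q \<or> (snd p = snd q \<and> fst p \<le> fst q)"

definition embeds_two_times :: "(bool \<times> 'l::linorder \<Rightarrow> real) \<Rightarrow> real set \<Rightarrow> bool" where
  "embeds_two_times e D \<longleftrightarrow>
     (\<forall>p. e p \<in> D) \<and> inj e \<and> (\<forall>p q. antilex_le p q \<longleftrightarrow> e p \<le> e q)"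


section \<open>Trees over a linear order\<close>

record ('a, 'l) ltree =
  nodes :: "'a set"
  tle :: "'a rel"
  lev :: "'a \<Rightarrow> 'l"

definition tree_less :: "('a, 'l::linorder) ltree \<Rightarrow> 'a \<Rightarrow> 'a \<Rightarrow> bool" where
  "tree_less T s t \<longleftrightarrow> (s, t) \<in> tle T \<and> s \<noteq> t"

definition incomparable :: "('a, 'l::linorder) ltree \<Rightarrow> 'a \<Rightarrow> 'a \<Rightarrow> bool" where
  "incomparable T s t \<longleftrightarrow> (s, t) \<notin> tle T \<and> (t, s) \<notin> tle T"

text \<open>\<open>tree_up T t l\<close> is the node of level \<open>l\<close> above \<open>t\<close>, written \<open>t|\<^sub>l\<close>; it is meaningful only
  for \<open>l \<ge> lev T t\<close>.\<close>

definition tree_up :: "('a, 'l::linorder) ltree \<Rightarrow> 'a \<Rightarrow> 'l \<Rightarrow> 'a" where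
  "tree_up T t l = (THE t'. t' \<in> nodes T \<and> (t, t') \<in> tle T \<and> lev T t' = l)"

definition split_levels :: "('a, 'l::linorder) ltree \<Rightarrow> 'a \<Rightarrow> 'a \<Rightarrow> 'l set" where
  "split_levels T s t = {l. l \<ge> max (lev T s) (lev T t) \<and> tree_up T s l \<noteq> tree_up T t l}"

text \<open>\<open>Greatest\<close> rather than \<open>Max\<close>, because the set may be infinite.\<close>

definition spl :: "('a, 'l::linorder) ltree \<Rightarrow> 'a \<Rightarrow> 'a \<Rightarrow> 'l" where
  "spl T s t = (GREATEST l. l \<in> split_levels T s t)"

text \<open>\<open>partial_order_on\<close> includes \<open>tle T \<subseteq> nodes T \<times> nodes T\<close>; with \<open>lev T\<close> extensional,
  two trees are equal as records iff they are equal as triples.\<close>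

definition L_tree :: "('a, 'l::linorder) ltree \<Rightarrow> bool" where
  "L_tree T \<longleftrightarrow>
     partial_order_on (nodes T) (tle T) \<and>
     lev T \<in> extensional (nodes T) \<and> lev T ` nodes T = UNIV \<and>
     (\<forall>s\<in>nodes T. \<forall>t\<in>nodes T. tree_less T s t \<longrightarrow> lev T s < lev T t) \<and>
     (\<forall>t\<in>nodes T. \<forall>l\<ge>lev T t. \<exists>!t'. t' \<in> nodes T \<and> (t, t') \<in> tle T \<and> lev T t' = l) \<and>
     (\<forall>s\<in>nodes T. \<forall>t\<in>nodes T. \<exists>l\<ge>max (lev T s) (lev T t). tree_up T s l = tree_up T t l) \<and>
     (\<forall>s\<in>nodes T. \<forall>t\<in>nodes T. incomparable T s t \<longrightarrow>
        (\<exists>m\<in>split_levels T s t. \<forall>l\<in>split_levels T s t. l \<le> m))"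

definition is_branch :: "('a, 'l::linorder) ltree \<Rightarrow> ('l \<Rightarrow> 'a) \<Rightarrow> bool" where
  "is_branch T b \<longleftrightarrow> (\<forall>l. b l \<in> nodes T \<and> lev T (b l) = l) \<and>
     (\<forall>l l'. l \<le> l' \<longrightarrow> (b l, b l') \<in> tle T)"

definition pruned :: "('a, 'l::linorder) ltree \<Rightarrow> bool" where
  "pruned T \<longleftrightarrow> (\<forall>t\<in>nodes T. \<exists>b. is_branch T b \<and> t = b (lev T t))"

definition tree_embeddings ::
    "('a, 'l::linorder) ltree \<Rightarrow> ('a, 'l) ltree \<Rightarrow> ('a \<Rightarrow> 'a) set" where
  "tree_embeddings T T' = {f \<in> nodes T \<rightarrow>\<^sub>E nodes T'. inj_on f (nodes T) \<and>
     (\<forall>t\<in>nodes T. lev T' (f t) = lev T t) \<and>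
     (\<forall>s\<in>nodes T. \<forall>t\<in>nodes T. (s, t) \<in> tle T \<longleftrightarrow> (f s, f t) \<in> tle T')}"

text \<open>Objects are the pruned trees whose nodes are drawn from the type \<open>'a\<close>, which is arbitrary
  and serves as the universe.\<close>

definition pruned_tree_cat :: "(('a, 'l::linorder) ltree, 'a \<Rightarrow> 'a) cat" where
  "pruned_tree_cat =
     \<lparr>Obj = {T. L_tree T \<and> pruned T},
      Hom = tree_embeddings,
      Id = (\<lambda>T. \<lambda>t\<in>nodes T. t),
      Comp = (\<lambda>A B E g f. compose (nodes A) g f)\<rparr>"


section \<open>Ultrametric spaces\<close>

record 'a dspace =
  points :: "'a set"
  dst :: "'a \<Rightarrow> 'a \<Rightarrow> real"

definition discrete_ultrametric :: "real set \<Rightarrow> 'a dspace \<Rightarrow> bool" where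
  "discrete_ultrametric D X \<longleftrightarrow>
     points X \<noteq> {} \<and> Metric_space (points X) (dst X) \<and>
     (\<forall>x\<in>points X. \<forall>y\<in>points X. \<forall>z\<in>points X. dst X x z \<le> max (dst X x y) (dst X y z)) \<and>
     Metric_space.mcomplete (points X) (dst X) \<and>
     Metric_space.mtopology (points X) (dst X) = discrete_topology (points X) \<and>
     (\<forall>x\<in>points X. \<forall>y\<in>points X. x \<noteq> y \<longrightarrow> dst X x y \<in> D) \<and>
     (\<forall>x y. x \<notin> points X \<or> y \<notin> points X \<longrightarrow> dst X x y = 0)"
     \<comment> \<open>the last clause only makes equality of records coincide with equality of spaces\<close>

definition isometric_embeddings :: "'a dspace \<Rightarrow> 'a dspace \<Rightarrow> ('a \<Rightarrow> 'a) set" where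
  "isometric_embeddings X Y = {f \<in> points X \<rightarrow>\<^sub>E points Y.
     \<forall>x\<in>points X. \<forall>y\<in>points X. dst Y (f x) (f y) = dst X x y}"

definition discrete_ultrametric_cat :: "real set \<Rightarrow> ('a dspace, 'a \<Rightarrow> 'a) cat" where
  "discrete_ultrametric_cat D =
     \<lparr>Obj = {X. discrete_ultrametric D X},
      Hom = isometric_embeddings,
      Id = (\<lambda>X. \<lambda>x\<in>points X. x),
      Comp = (\<lambda>X Y Z g f. compose (points X) g f)\<rparr>"

definition uniformly_discrete :: "'a dspace \<Rightarrow> bool" where
  "uniformly_discrete X \<longleftrightarrow>
     (\<exists>\<epsilon>>0. \<forall>x\<in>points X. \<forall>y\<in>points X. x \<noteq> y \<longrightarrow> \<epsilon> \<le> dst X x y)"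

definition is_base :: "'a topology \<Rightarrow> 'a set set \<Rightarrow> bool" where
  "is_base X \<B> \<longleftrightarrow> (\<forall>V\<in>\<B>. openin X V) \<and>
     (\<forall>U x. openin X U \<and> x \<in> U \<longrightarrow> (\<exists>V\<in>\<B>. x \<in> V \<and> V \<subseteq> U))"

text \<open>The least cardinality of a base, determined up to \<open>=o\<close>.\<close>

definition weight :: "'a topology \<Rightarrow> 'a set rel" where
  "weight X = |SOME \<B>. is_base X \<B> \<and> (\<forall>\<C>. is_base X \<C> \<longrightarrow> |\<B>| \<le>o |\<C>| )|"

lemma weight_least:
  "\<exists>\<B>. is_base X \<B> \<and> weight X = |\<B>| \<and> (\<forall>\<C>. is_base X \<C> \<longrightarrow> weight X \<le>o |\<C>| )"
proof -
  define R where "R = card_of ` {\<B>. is_base X \<B>}"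
  have "is_base X {U. openin X U}"
    unfolding is_base_def by auto
  then have "R \<noteq> {}" unfolding R_def by blast
  moreover have "\<forall>r\<in>R. Card_order r"
    unfolding R_def by (simp add: card_of_Card_order)
  ultimately have "\<exists>r\<in>R. \<forall>r'\<in>R. r \<le>o r'"
    by (intro exists_minim_Card_order)
  then have "\<exists>\<B>. is_base X \<B> \<and> (\<forall>\<C>. is_base X \<C> \<longrightarrow> |\<B>| \<le>o |\<C>| )"
    unfolding R_def by simp
  from someI_ex[OF this] show ?thesis
    unfolding weight_def by (intro exI conjI) (erule conjunct1, rule refl, erule conjunct2)
qed


section \<open>The ultrametric space of a tree\<close>

text \<open>\<open>e (False, l)\<close> and \<open>e (True, l)\<close> are \<open>l\<^sup>-\<close> and \<open>l\<^sup>+\<close>. The first branch is the normalization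
  outside of the carrier.\<close>

definition tree_space :: "(bool \<times> 'l::linorder \<Rightarrow> real) \<Rightarrow> ('a, 'l) ltree \<Rightarrow> 'a dspace" where
  "tree_space e T =
     \<lparr>points = nodes T,
      dst = (\<lambda>s t. if s \<notin> nodes T \<or> t \<notin> nodes T then 0
                   else if s = t then 0
                   else if tree_less T s t then e (False, lev T t)
                   else if tree_less T t s then e (False, lev T s)
                   else e (True, spl T s t))\<rparr>"

end

theory Submission
  imports Defs
begin

text \<open>
  The distance of two distinct nodes is at most \<open>\<ell>\<^sup>+\<close> (at most \<open>\<ell>\<^sup>-\<close>) iff both have level at most
  \<open>\<ell>\<close> and they have the same node above them at every level greater than \<open>\<ell>\<close> (at least \<open>\<ell>\<close>).
  These relations are transitive, whence the ultrametric inequality.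

  For fullness, an isometric embedding \<open>f\<close> preserves comparability, and it preserves the greater of
  the levels of two comparable nodes. Given \<open>u < s < t\<close>, suppose that \<open>f t < f s\<close>. Then \<open>f s\<close> has the
  level of \<open>t\<close>, and comparing \<open>u\<close> with \<open>t\<close> shows that \<open>f u\<close> has it, too; but the greater of the levels
  of \<open>f u\<close> and \<open>f s\<close> is that of \<open>s\<close>. So \<open>f\<close> preserves order and levels above a chain of two nodes, and
  such chains exist below every node that is not of minimal level, because the tree is pruned. The
  image of a node of minimal level lies below the images of all its successors, whose levels are
  preserved, so its level is minimal, too.

  Injectivity on objects follows from fullness applied to the identity.
\<close>

section \<open>Topology, completeness and weight of uniformly discrete spaces\<close>

lemma uniformly_discrete_Metric_space:
  assumes "Metric_space M d" and "\<epsilon> > 0"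
    and sep: "\<And>x y. \<lbrakk>x \<in> M; y \<in> M; x \<noteq> y\<rbrakk> \<Longrightarrow> \<epsilon> \<le> d x y"
  shows "Metric_space.mtopology M d = discrete_topology M" and "Metric_space.mcomplete M d"
proof -
  interpret Metric_space M d by fact
  have "openin mtopology {x}" if "x \<in> M" for x
  proof -
    have "mball x \<epsilon> = {x}"
      using sep that \<open>\<epsilon> > 0\<close> by (force simp: mball_def)
    then show ?thesis
      by (metis openin_mball)
  qed
  then show "mtopology = discrete_topology M"
    by (metis discrete_topology_unique topspace_mtopology)
  show mcomplete
    unfolding mcomplete_def
  proof (intro allI impI)
    fix \<sigma> assume \<sigma>: "MCauchy \<sigma>"
    then obtain N where N: "\<And>n n'. N \<le> n \<Longrightarrow> N \<le> n' \<Longrightarrow> d (\<sigma> n) (\<sigma> n') < \<epsilon>"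
      using \<open>\<epsilon> > 0\<close> unfolding MCauchy_def by meson
    have \<sigma>_in: "\<sigma> n \<in> M" for n
      using \<sigma> by (auto simp: MCauchy_def)
    \<comment> \<open>Terms closer than the separation constant coincide, so a Cauchy sequence is
      eventually constant.\<close>
    have "\<sigma> n = \<sigma> N" if "n \<ge> N" for n
    proof (rule ccontr)
      assume "\<sigma> n \<noteq> \<sigma> N"
      then show False
        using sep[OF \<sigma>_in \<sigma>_in] N[OF that order.refl] by (simp add: not_le[symmetric])
    qed
    then have "eventually (\<lambda>n. \<sigma> n = \<sigma> N) sequentially"
      by (rule eventually_sequentiallyI)
    with \<sigma>_in have "limitin mtopology \<sigma> (\<sigma> N) sequentially"
      by (simp add: limitin_eventually)
    then show "\<exists>x. limitin mtopology \<sigma> x sequentially" ..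
  qed
qed

text \<open>The singletons form a base and belong to every base, because a basic set that contains
  \<open>x\<close> and lies in \<open>{x}\<close> is \<open>{x}\<close>.\<close>

lemma weight_discrete_topology: "weight (discrete_topology S) =o |S|"
proof -
  obtain \<B> where \<B>: "is_base (discrete_topology S) \<B>" "weight (discrete_topology S) = |\<B>|"
    and least: "\<And>\<C>. is_base (discrete_topology S) \<C> \<Longrightarrow> |\<B>| \<le>o |\<C>|"
    using weight_least[of "discrete_topology S"] by metis
  define sing where "sing = (\<lambda>x. {x}) ` S"
  have S: "|S| =o |sing|"
    by (rule card_of_ordIsoI[of "\<lambda>x. {x}"]) (simp add: sing_def bij_betw_def)
  have "is_base (discrete_topology S) sing"
    by (auto simp: is_base_def sing_def)
  then have "|\<B>| \<le>o |sing|"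
    by (rule least)
  moreover have "sing \<subseteq> \<B>"
  proof
    fix V assume "V \<in> sing"
    then obtain x where x: "V = {x}" "x \<in> S"
      by (auto simp: sing_def)
    then obtain W where "W \<in> \<B>" "x \<in> W" "W \<subseteq> {x}"
      using \<B>(1) unfolding is_base_def
      by (metis empty_subsetI insert_subset openin_discrete_topology singletonI)
    with x show "V \<in> \<B>"
      by (metis empty_iff subset_singletonD)
  qed
  ultimately have "|\<B>| =o |sing|"
    by (simp add: ordIso_iff_ordLeq card_of_mono1)
  with S \<B>(2) show ?thesis
    by (metis ordIso_symmetric ordIso_transitive)
qed

section \<open>The two categories\<close>

lemma category_pruned_tree_cat: "category pruned_tree_cat"
proof
  fix A :: "('a, 'l::linorder) ltree" and B E f g
  assume "f \<in> Hom pruned_tree_cat A B" "g \<in> Hom pruned_tree_cat B E"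
  then have f: "f \<in> nodes A \<rightarrow>\<^sub>E nodes B" "inj_on f (nodes A)"
      "\<And>t. t \<in> nodes A \<Longrightarrow> lev B (f t) = lev A t"
      "\<And>s t. s \<in> nodes A \<Longrightarrow> t \<in> nodes A \<Longrightarrow> (f s, f t) \<in> tle B \<longleftrightarrow> (s, t) \<in> tle A"
    and g: "g \<in> nodes B \<rightarrow>\<^sub>E nodes E" "inj_on g (nodes B)"
      "\<And>t. t \<in> nodes B \<Longrightarrow> lev E (g t) = lev B t"
      "\<And>s t. s \<in> nodes B \<Longrightarrow> t \<in> nodes B \<Longrightarrow> (g s, g t) \<in> tle E \<longleftrightarrow> (s, t) \<in> tle B"
    by (auto simp: pruned_tree_cat_def tree_embeddings_def)
  have fB: "f t \<in> nodes B" if "t \<in> nodes A" for t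
    using f(1) that by auto
  have "inj_on (compose (nodes A) g f) (nodes A)"
    using f(2) g(2) fB by (auto simp: inj_on_def compose_eq)
  moreover have "compose (nodes A) g f \<in> nodes A \<rightarrow>\<^sub>E nodes E"
    using f(1) g(1) by (auto simp: PiE_iff compose_eq)
  ultimately show "Comp pruned_tree_cat A B E g f \<in> Hom pruned_tree_cat A E"
    by (simp add: pruned_tree_cat_def tree_embeddings_def compose_eq f(3,4) g(3,4) fB)
qed (auto simp: pruned_tree_cat_def tree_embeddings_def PiE_def
      intro: compose_Id Id_compose compose_assoc)

lemma category_discrete_ultrametric_cat: "category (discrete_ultrametric_cat D)"
proof
  fix A :: "'a dspace" and B E f g
  assume "f \<in> Hom (discrete_ultrametric_cat D) A B" "g \<in> Hom (discrete_ultrametric_cat D) B E"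
  then have f: "f \<in> points A \<rightarrow>\<^sub>E points B"
      "\<And>x y. x \<in> points A \<Longrightarrow> y \<in> points A \<Longrightarrow> dst B (f x) (f y) = dst A x y"
    and g: "g \<in> points B \<rightarrow>\<^sub>E points E"
      "\<And>x y. x \<in> points B \<Longrightarrow> y \<in> points B \<Longrightarrow> dst E (g x) (g y) = dst B x y"
    by (auto simp: discrete_ultrametric_cat_def isometric_embeddings_def)
  have fB: "f x \<in> points B" if "x \<in> points A" for x
    using f(1) that by auto
  have "compose (points A) g f \<in> points A \<rightarrow>\<^sub>E points E"
    using f(1) g(1) by (auto simp: PiE_iff compose_eq)
  then show "Comp (discrete_ultrametric_cat D) A B E g f \<in> Hom (discrete_ultrametric_cat D) A E"
    by (simp add: discrete_ultrametric_cat_def isometric_embeddings_def compose_eq f(2) g(2) fB)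
qed (auto simp: discrete_ultrametric_cat_def isometric_embeddings_def PiE_def
      intro: compose_Id Id_compose compose_assoc)

section \<open>Levels, restrictions and splitting in a tree\<close>

locale L_tree_loc =
  fixes T :: "('a, 'l::linorder) ltree"
  assumes L_tree: "L_tree T"
begin

lemma tle_refl: "t \<in> nodes T \<Longrightarrow> (t, t) \<in> tle T"
  and tle_trans: "(s, t) \<in> tle T \<Longrightarrow> (t, u) \<in> tle T \<Longrightarrow> (s, u) \<in> tle T"
  and tle_antisym: "(s, t) \<in> tle T \<Longrightarrow> (t, s) \<in> tle T \<Longrightarrow> s = t"
  and tle_nodes: "(s, t) \<in> tle T \<Longrightarrow> s \<in> nodes T \<and> t \<in> nodes T"
  using L_tree unfolding L_tree_def partial_order_on_def preorder_on_def
  by (auto dest: refl_onD transD antisymD)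

lemma nodes_nonempty: "nodes T \<noteq> {}"
  using L_tree unfolding L_tree_def by auto

lemma lev_less: "tree_less T s t \<Longrightarrow> lev T s < lev T t"
  using L_tree tle_nodes unfolding L_tree_def by (metis tree_less_def)

lemma lev_le: "(s, t) \<in> tle T \<Longrightarrow> lev T s \<le> lev T t"
  using lev_less by (metis order.refl order.strict_implies_order tree_less_def)

lemma tree_up_eqI:
  assumes "(s, t) \<in> tle T"
  shows "tree_up T s (lev T t) = t"
proof -
  have "\<exists>!t'. t' \<in> nodes T \<and> (s, t') \<in> tle T \<and> lev T t' = lev T t"
    using L_tree assms lev_le tle_nodes unfolding L_tree_def by blast
  with assms tle_nodes show ?thesis
    unfolding tree_up_def by (metis (mono_tags, lifting) the1_equality)
qed

lemma tree_up_above: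
  assumes "t \<in> nodes T" and "lev T t \<le> l"
  shows "(t, tree_up T t l) \<in> tle T" and "lev T (tree_up T t l) = l"
proof -
  obtain t' where t': "(t, t') \<in> tle T" "lev T t' = l"
    using L_tree assms unfolding L_tree_def by meson
  then have "tree_up T t l = t'"
    using tree_up_eqI by blast
  with t' show "(t, tree_up T t l) \<in> tle T" "lev T (tree_up T t l) = l"
    by simp_all
qed

text \<open>The node above \<open>t\<close> at level \<open>l\<close> is also above
  \<open>s\<close>, and there is only one such node.\<close>

lemma tree_up_cong: "(s, t) \<in> tle T \<Longrightarrow> lev T t \<le> l \<Longrightarrow> tree_up T s l = tree_up T t l"
  by (metis tle_nodes tle_trans tree_up_above tree_up_eqI)

lemma spl_in_split_levels:
  assumes "s \<in> nodes T" "t \<in> nodes T" "incomparable T s t"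
  shows "spl T s t \<in> split_levels T s t"
    and "\<And>l. l \<in> split_levels T s t \<Longrightarrow> l \<le> spl T s t"
proof -
  obtain m where m: "m \<in> split_levels T s t" "\<And>l. l \<in> split_levels T s t \<Longrightarrow> l \<le> m"
    using L_tree assms unfolding L_tree_def by metis
  then have "spl T s t = m"
    unfolding spl_def by (intro Greatest_equality) auto
  with m show "spl T s t \<in> split_levels T s t" "\<And>l. l \<in> split_levels T s t \<Longrightarrow> l \<le> spl T s t"
    by simp_all
qed

lemma spl_commute: "spl T s t = spl T t s"
  unfolding spl_def split_levels_def by (simp add: max.commute eq_commute)

text \<open>A branch through \<open>t\<close> visits every level, in particular those below
  \<open>t\<close>.\<close>

lemma pruned_obtain_below:
  assumes "pruned T" "t \<in> nodes T" "l < lev T t"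
  obtains s where "tree_less T s t" "lev T s = l"
proof -
  obtain b where b: "is_branch T b" "t = b (lev T t)"
    using assms unfolding pruned_def by blast
  then have "(b l, t) \<in> tle T" "lev T (b l) = l"
    using assms(3) unfolding is_branch_def by (metis order.strict_implies_order)+
  then show ?thesis
    using assms(3) that[of "b l"] unfolding tree_less_def by force
qed

end

section \<open>Tree embeddings are isometric\<close>

lemma tree_up_tree_embedding:
  assumes "L_tree A" "L_tree B" and f: "f \<in> tree_embeddings A B"
    and "t \<in> nodes A" "lev A t \<le> l"
  shows "tree_up B (f t) l = f (tree_up A t l)"
proof -
  interpret A: L_tree_loc A by standard fact
  interpret B: L_tree_loc B by standard fact
  note up = A.tree_up_above[OF assms(4,5)]
  then have "(f t, f (tree_up A t l)) \<in> tle B" "lev B (f (tree_up A t l)) = l"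
    using f A.tle_nodes[OF up(1)] by (auto simp: tree_embeddings_def)
  then show ?thesis
    using B.tree_up_eqI by metis
qed

text \<open>\<open>f\<close> commutes with restriction to a level and is injective, so the two pairs
  agree at the same levels and have equal sets of split levels.\<close>

lemma spl_tree_embedding:
  assumes "L_tree A" "L_tree B" and f: "f \<in> tree_embeddings A B"
    and "s \<in> nodes A" "t \<in> nodes A"
  shows "spl B (f s) (f t) = spl A s t"
proof -
  interpret A: L_tree_loc A by standard fact
  have lev: "lev B (f s) = lev A s" "lev B (f t) = lev A t" and inj: "inj_on f (nodes A)"
    using f assms(4,5) by (auto simp: tree_embeddings_def)
  have "f (tree_up A s l) = f (tree_up A t l) \<longleftrightarrow> tree_up A s l = tree_up A t l"
    if "lev A s \<le> l" "lev A t \<le> l" for l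
    using that assms(4,5) A.tree_up_above(1) A.tle_nodes inj by (metis inj_on_eq_iff)
  then have "split_levels B (f s) (f t) = split_levels A s t"
    unfolding split_levels_def lev using tree_up_tree_embedding[OF assms(1-3)] assms(4,5) by auto
  then show ?thesis
    by (simp add: spl_def)
qed

lemma points_tree_space [simp]: "points (tree_space e T) = nodes T"
  by (simp add: tree_space_def)

lemma tree_embedding_isometric:
  assumes "L_tree A" "L_tree B" and f: "f \<in> tree_embeddings A B"
  shows "f \<in> isometric_embeddings (tree_space e A) (tree_space e B)"
proof -
  have "dst (tree_space e B) (f s) (f t) = dst (tree_space e A) s t"
    if st: "s \<in> nodes A" "t \<in> nodes A" for s t
  proof -
    have "f s \<in> nodes B" "f t \<in> nodes B" "f s = f t \<longleftrightarrow> s = t"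
      "tree_less B (f s) (f t) \<longleftrightarrow> tree_less A s t" "tree_less B (f t) (f s) \<longleftrightarrow> tree_less A t s"
      "lev B (f s) = lev A s" "lev B (f t) = lev A t"
      using f st by (auto simp: tree_embeddings_def tree_less_def inj_on_eq_iff)
    with st show ?thesis
      by (simp add: tree_space_def spl_tree_embedding[OF assms])
  qed
  with f show ?thesis
    by (simp add: isometric_embeddings_def tree_embeddings_def)
qed

section \<open>The ultrametric of a tree\<close>

locale separated_embedding =
  fixes D :: "real set" and e :: "bool \<times> 'l::linorder \<Rightarrow> real"
  assumes D_pos: "D \<subseteq> {0<..}" and Inf_D_pos: "Inf D > 0" and emb: "embeds_two_times e D"
begin

lemma e_in_D: "e p \<in> D"
  using emb unfolding embeds_two_times_def by blast

lemma e_eq_iff [simp]: "e p = e q \<longleftrightarrow> p = q"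
  and e_le_iff: "e (b, l) \<le> e (b', l') \<longleftrightarrow> l < l' \<or> l = l' \<and> (b \<longrightarrow> b')"
  using emb unfolding embeds_two_times_def antilex_le_def by (auto simp: inj_eq)

lemma e_pos: "0 < e p"
  using e_in_D[of p] D_pos by auto

lemma e_nonzero [simp]: "e p \<noteq> 0" "0 \<noteq> e p"
  using e_pos[of p] by auto

lemma Inf_D_le: "x \<in> D \<Longrightarrow> Inf D \<le> x"
  using D_pos by (intro cInf_lower bdd_belowI[of _ 0]) auto

lemma dst_tree_space_refl: "dst (tree_space e T) t t = 0"
  by (simp add: tree_space_def)

text \<open>Levels increase strictly along the order, so the greater of two comparable nodes has the
  greater level; \<open>max\<close> thus covers both directions at once.\<close>

lemma dst_tree_space_cases:
  assumes "L_tree T" "s \<in> nodes T" "t \<in> nodes T"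
  obtains (eq) "s = t" "dst (tree_space e T) s t = 0"
  | (comparable) "s \<noteq> t" "(s, t) \<in> tle T \<or> (t, s) \<in> tle T"
      "dst (tree_space e T) s t = e (False, max (lev T s) (lev T t))"
  | (incomparable) "s \<noteq> t" "incomparable T s t" "dst (tree_space e T) s t = e (True, spl T s t)"
proof -
  interpret L_tree_loc T by standard fact
  consider "s = t" | "tree_less T s t" | "s \<noteq> t" "\<not> tree_less T s t" "tree_less T t s"
    | "s \<noteq> t" "\<not> tree_less T s t" "\<not> tree_less T t s"
    by blast
  then show thesis
  proof cases
    case 1
    then show ?thesis
      using assms eq by (simp add: tree_space_def)
  next
    case 2
    then have "s \<noteq> t" "(s, t) \<in> tle T" "lev T s < lev T t"
      using lev_less by (auto simp: tree_less_def)
    with 2 assms comparable show ?thesis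
      by (simp add: tree_space_def max_absorb2)
  next
    case 3
    then have "(t, s) \<in> tle T" "lev T t < lev T s"
      using lev_less by (auto simp: tree_less_def)
    with 3 assms comparable show ?thesis
      by (simp add: tree_space_def max_absorb1)
  next
    case 4
    then have "incomparable T s t"
      by (auto simp: tree_less_def incomparable_def)
    with 4 assms incomparable show ?thesis
      by (simp add: tree_space_def)
  qed
qed

text \<open>As \<open>e\<close> is injective and nonzero, its values at \<open>False\<close> occur
  only as distances of distinct comparable nodes. This lets an isometry preserve comparability and
  the greater level.\<close>

lemma dst_tree_space_eq_e_False_iff:
  assumes "L_tree T" "s \<in> nodes T" "t \<in> nodes T"
  shows "dst (tree_space e T) s t = e (False, l) \<longleftrightarrow>
    s \<noteq> t \<and> ((s, t) \<in> tle T \<or> (t, s) \<in> tle T) \<and> max (lev T s) (lev T t) = l"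
  using dst_tree_space_cases[OF assms] by cases (auto simp: incomparable_def)

lemma dst_tree_space_commute:
  assumes "L_tree T"
  shows "dst (tree_space e T) s t = dst (tree_space e T) t s"
proof -
  interpret L_tree_loc T by standard fact
  show ?thesis
    using lev_less[of s t] lev_less[of t s] spl_commute[of s t] by (auto simp: tree_space_def)
qed

lemma dst_tree_space_in_D:
  assumes "L_tree T" "s \<in> nodes T" "t \<in> nodes T" "s \<noteq> t"
  shows "dst (tree_space e T) s t \<in> D"
  using dst_tree_space_cases[OF assms(1-3)] assms(4) by cases (auto simp: e_in_D)

lemma dst_tree_space_nonneg: "0 \<le> dst (tree_space e T) s t"
  using e_pos by (auto simp: tree_space_def intro: less_imp_le)

text \<open>Comparable nodes agree at all levels from the greater one on; incomparable ones differ
  at \<open>spl T s t\<close> and agree above it. The condition on \<open>k\<close> exempts level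
  \<open>l\<close> itself exactly when the bound is \<open>e (True, l)\<close>.\<close>

lemma dst_tree_space_le_e_iff:
  assumes T: "L_tree T" and st: "s \<in> nodes T" "t \<in> nodes T" "s \<noteq> t"
  shows "dst (tree_space e T) s t \<le> e (b, l) \<longleftrightarrow>
    lev T s \<le> l \<and> lev T t \<le> l \<and> (\<forall>k\<ge>l. (b \<longrightarrow> k \<noteq> l) \<longrightarrow> tree_up T s k = tree_up T t k)"
proof -
  interpret L_tree_loc T by standard fact
  from T st(1,2) show ?thesis
  proof (cases rule: dst_tree_space_cases)
    case eq
    with st show ?thesis by simp
  next
    case comparable
    then have "tree_up T s k = tree_up T t k" if "lev T s \<le> k" "lev T t \<le> k" for k
      using tree_up_cong that by metis
    then show ?thesis
      unfolding comparable(3) e_le_iff by (auto simp: max_def)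
  next
    case incomparable
    note spl = spl_in_split_levels[OF st(1,2) incomparable(2)]
    have spl1: "lev T s \<le> spl T s t" "lev T t \<le> spl T s t"
        "tree_up T s (spl T s t) \<noteq> tree_up T t (spl T s t)"
      using spl(1) by (auto simp: split_levels_def)
    have spl2: "tree_up T s k = tree_up T t k" if "spl T s t < k" for k
      using spl(2)[of k] that spl1 unfolding split_levels_def by force
    show ?thesis
      unfolding incomparable(3) e_le_iff
    proof (intro iffI)
      assume "spl T s t < l \<or> spl T s t = l \<and> (True \<longrightarrow> b)"
      then show "lev T s \<le> l \<and> lev T t \<le> l \<and>
          (\<forall>k\<ge>l. (b \<longrightarrow> k \<noteq> l) \<longrightarrow> tree_up T s k = tree_up T t k)"
        using spl1 spl2 by (auto intro: order.trans)
    next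
      assume "lev T s \<le> l \<and> lev T t \<le> l \<and>
          (\<forall>k\<ge>l. (b \<longrightarrow> k \<noteq> l) \<longrightarrow> tree_up T s k = tree_up T t k)"
      \<comment> \<open>Otherwise \<open>k = spl T s t\<close> is an admissible level, at which the
        nodes differ.\<close>
      then show "spl T s t < l \<or> spl T s t = l \<and> (True \<longrightarrow> b)"
        using spl1(3) by (metis linorder_not_less order.refl)
    qed
  qed
qed

lemma dst_tree_space_ultrametric:
  assumes T: "L_tree T" and nodes: "x \<in> nodes T" "y \<in> nodes T" "z \<in> nodes T"
  shows "dst (tree_space e T) x z \<le> max (dst (tree_space e T) x y) (dst (tree_space e T) y z)"
proof (cases "x = y \<or> y = z \<or> x = z")
  case True
  then show ?thesis
    using dst_tree_space_nonneg by (auto simp: le_max_iff_disj dst_tree_space_refl)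
next
  case False
  obtain p q where p: "dst (tree_space e T) x y = e p" and q: "dst (tree_space e T) y z = e q"
    using dst_tree_space_cases[OF T nodes(1,2)] dst_tree_space_cases[OF T nodes(2,3)] False by metis
  \<comment> \<open>The maximum is itself a value of \<open>e\<close>, a common bound to which the
    characterization of distinct nodes applies; its right-hand side is transitive.\<close>
  then obtain b l where "max (dst (tree_space e T) x y) (dst (tree_space e T) y z) = e (b, l)"
    by (metis max_def surj_pair)
  moreover from this have "dst (tree_space e T) x y \<le> e (b, l)" "dst (tree_space e T) y z \<le> e (b, l)"
    by linarith+
  ultimately show ?thesis
    using False nodes by (simp add: dst_tree_space_le_e_iff[OF T])
qed

lemma Metric_space_tree_space:
  assumes "L_tree T"
  shows "Metric_space (nodes T) (dst (tree_space e T))"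
proof
  fix x y z assume xyz: "x \<in> nodes T" "y \<in> nodes T" "z \<in> nodes T"
  show "dst (tree_space e T) x y = 0 \<longleftrightarrow> x = y"
    using dst_tree_space_cases[OF assms xyz(1,2)] by cases simp_all
  show "dst (tree_space e T) x z \<le> dst (tree_space e T) x y + dst (tree_space e T) y z"
    using dst_tree_space_ultrametric[OF assms xyz] dst_tree_space_nonneg[of T x y]
      dst_tree_space_nonneg[of T y z] by linarith
qed (rule dst_tree_space_nonneg, rule dst_tree_space_commute[OF assms])

text \<open>The single constant \<open>Inf D\<close> yields the discrete topology, completeness and
  uniform discreteness.\<close>

lemma Inf_D_le_dst_tree_space:
  "\<lbrakk>L_tree T; s \<in> nodes T; t \<in> nodes T; s \<noteq> t\<rbrakk> \<Longrightarrow> Inf D \<le> dst (tree_space e T) s t"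
  by (intro Inf_D_le dst_tree_space_in_D)

lemma mtopology_tree_space:
  assumes "L_tree T"
  shows "Metric_space.mtopology (nodes T) (dst (tree_space e T)) = discrete_topology (nodes T)"
  by (intro uniformly_discrete_Metric_space(1)[OF Metric_space_tree_space Inf_D_pos]
      Inf_D_le_dst_tree_space assms)

lemma uniformly_discrete_tree_space: "L_tree T \<Longrightarrow> uniformly_discrete (tree_space e T)"
  using Inf_D_le_dst_tree_space Inf_D_pos
  by (auto simp: uniformly_discrete_def intro!: exI[of _ "Inf D"])

lemma discrete_ultrametric_tree_space:
  assumes "L_tree T"
  shows "discrete_ultrametric D (tree_space e T)"
proof -
  interpret L_tree_loc T by standard fact
  have "Metric_space.mcomplete (nodes T) (dst (tree_space e T))"
    by (intro uniformly_discrete_Metric_space(2)[OF Metric_space_tree_space Inf_D_pos]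
        Inf_D_le_dst_tree_space assms)
  moreover have "dst (tree_space e T) s t = 0" if "s \<notin> nodes T \<or> t \<notin> nodes T" for s t
    using that by (auto simp: tree_space_def)
  ultimately show ?thesis
    using assms nodes_nonempty
    by (simp add: discrete_ultrametric_def Metric_space_tree_space dst_tree_space_ultrametric
        mtopology_tree_space dst_tree_space_in_D)
qed

section \<open>Fullness: isometric embeddings are tree embeddings\<close>

lemma isometric_tree_embedding:
  assumes A: "L_tree A" "pruned A" and B: "L_tree B"
    and levels: "\<And>l::'l. (\<forall>x. l \<le> x) \<or> (\<exists>j k. j < k \<and> k < l)"
    and f: "f \<in> isometric_embeddings (tree_space e A) (tree_space e B)"
  shows "f \<in> tree_embeddings A B"
proof -
  interpret A: L_tree_loc A by standard fact
  interpret B: L_tree_loc B by standard fact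
  have fB: "f \<in> nodes A \<rightarrow>\<^sub>E nodes B" "\<And>t. t \<in> nodes A \<Longrightarrow> f t \<in> nodes B"
    and iso: "\<And>s t. s \<in> nodes A \<Longrightarrow> t \<in> nodes A \<Longrightarrow>
      dst (tree_space e B) (f s) (f t) = dst (tree_space e A) s t"
    using f by (auto simp: isometric_embeddings_def)
  have f_eq: "f s = f t \<longleftrightarrow> s = t" if "s \<in> nodes A" "t \<in> nodes A" for s t
    using iso[OF that] that fB(2) Metric_space.zero[OF Metric_space_tree_space] A(1) B by metis
  have comparable: "s \<noteq> t \<and> ((f s, f t) \<in> tle B \<or> (f t, f s) \<in> tle B) \<and>
        max (lev B (f s)) (lev B (f t)) = l
      \<longleftrightarrow> s \<noteq> t \<and> ((s, t) \<in> tle A \<or> (t, s) \<in> tle A) \<and> max (lev A s) (lev A t) = l"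
    if st: "s \<in> nodes A" "t \<in> nodes A" for s t l
    using dst_tree_space_eq_e_False_iff[OF A(1) st] f_eq[OF st] iso[OF st]
      dst_tree_space_eq_e_False_iff[OF B fB(2)[OF st(1)] fB(2)[OF st(2)]] by simp
  \<comment> \<open>So far \<open>f\<close> may reverse a pair; the greater image then still has the
    level of \<open>t\<close>.\<close>
  have less_cases: "tree_less B (f s) (f t) \<and> lev B (f t) = lev A t \<or>
      tree_less B (f t) (f s) \<and> lev B (f s) = lev A t" if "tree_less A s t" for s t
  proof -
    have st: "s \<in> nodes A" "t \<in> nodes A" "s \<noteq> t" "(s, t) \<in> tle A"
      using that A.tle_nodes by (auto simp: tree_less_def)
    then have "(f s, f t) \<in> tle B \<or> (f t, f s) \<in> tle B"
        and max: "max (lev B (f s)) (lev B (f t)) = lev A t"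
      using comparable[OF st(1,2), of "lev A t"] A.lev_le by (auto simp: max_absorb2)
    then consider "tree_less B (f s) (f t)" | "tree_less B (f t) (f s)"
      using f_eq[OF st(1,2)] st(3) by (auto simp: tree_less_def)
    then show ?thesis
      using B.lev_less max by cases (metis max.absorb4 max.absorb3)+
  qed
  have chain: "tree_less B (f s) (f t) \<and> lev B (f t) = lev A t"
    if us: "tree_less A u s" and st: "tree_less A s t" for u s t
  proof (rule ccontr)
    assume "\<not> ?thesis"
    then have flip: "tree_less B (f t) (f s)" "lev B (f s) = lev A t"
      using less_cases[OF st] by auto
    have "tree_less A u t"
      using us st A.tle_trans A.tle_antisym unfolding tree_less_def by metis
    \<comment> \<open>If \<open>f u < f t\<close>, then \<open>f t\<close> would have the level of
      \<open>t\<close>, but it lies strictly below \<open>f s\<close>, which has that level.\<close>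
    then have "lev B (f u) = lev A t"
      using less_cases[of u t] B.lev_less[OF flip(1)] flip(2) by auto
    \<comment> \<open>One of \<open>f u\<close> and \<open>f s\<close> must have the level of
      \<open>s\<close>, yet both have the level of \<open>t\<close>.\<close>
    with flip(2) less_cases[OF us] A.lev_less[OF st] show False
      by auto
  qed
  have chain_below: "\<exists>u s. tree_less A u s \<and> tree_less A s t"
    if t: "t \<in> nodes A" "\<not> (\<forall>x. lev A t \<le> x)" for t
  proof -
    \<comment> \<open>The order hypothesis provides two smaller levels, and branches provide nodes
      there.\<close>
    obtain j k where jk: "j < k" "k < lev A t"
      using levels t(2) by blast
    obtain s where s: "tree_less A s t" "lev A s = k"
      using A.pruned_obtain_below[OF A(2) t(1) jk(2)] .
    then have "s \<in> nodes A"
      using A.tle_nodes by (auto simp: tree_less_def)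
    then show ?thesis
      using A.pruned_obtain_below[OF A(2)] jk(1) s by metis
  qed
  have lev_nonmin: "lev B (f t) = lev A t" if "t \<in> nodes A" "\<not> (\<forall>x. lev A t \<le> x)" for t
    using chain chain_below[OF that] by blast
  have less: "tree_less B (f s) (f t)" if "tree_less A s t" for s t
  proof -
    have t: "t \<in> nodes A" "\<not> (\<forall>x. lev A t \<le> x)"
      using that A.tle_nodes A.lev_less[OF that] by (auto simp: tree_less_def not_le)
    \<comment> \<open>A reversal would put \<open>f t\<close> strictly below a node of its own
      level.\<close>
    show ?thesis
      using less_cases[OF that] lev_nonmin[OF t] B.lev_less by force
  qed
  have lev: "lev B (f t) = lev A t" if t: "t \<in> nodes A" for t
  proof (rule ccontr)
    assume neq: "lev B (f t) \<noteq> lev A t"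
    then have "lev A t < lev B (f t)"
      using lev_nonmin[OF t] by (metis order.not_eq_order_implies_strict)
    \<comment> \<open>Only a minimal level can fail to be preserved, so it is raised. The node
      \<open>u\<close> above \<open>t\<close> at the level of \<open>f t\<close> keeps its level,
      although \<open>f u\<close> must lie strictly above \<open>f t\<close>.\<close>
    define u where "u = tree_up A t (lev B (f t))"
    have u: "(t, u) \<in> tle A" "lev A u = lev B (f t)"
      using A.tree_up_above[OF t, of "lev B (f t)"] \<open>lev A t < lev B (f t)\<close> by (auto simp: u_def)
    then have "tree_less A t u"
      using neq by (auto simp: tree_less_def)
    moreover have "lev B (f u) = lev A u"
      using lev_nonmin[of u] u A.tle_nodes \<open>lev A t < lev B (f t)\<close> by (metis not_le)
    ultimately show False
      using less B.lev_less u(2) by force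
  qed
  have "(s, t) \<in> tle A \<longleftrightarrow> (f s, f t) \<in> tle B" if st: "s \<in> nodes A" "t \<in> nodes A" for s t
  proof (cases "s = t")
    case True
    then show ?thesis
      using A.tle_refl B.tle_refl fB(2) st by simp
  next
    case False
    then have "f s \<noteq> f t"
      using f_eq[OF st] by simp
    have "(s, t) \<in> tle A" if "(f s, f t) \<in> tle B"
    proof (rule ccontr)
      \<comment> \<open>Comparability is reflected, so the pair could only be ordered the other way,
        which \<open>f\<close> preserves.\<close>
      assume "(s, t) \<notin> tle A"
      then have "tree_less A t s"
        using comparable[OF st] that False by (auto simp: tree_less_def)
      then show False
        using less that B.tle_antisym \<open>f s \<noteq> f t\<close> by (auto simp: tree_less_def)
    qed
    then show ?thesis
      using less[of s t] False by (auto simp: tree_less_def)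
  qed
  with fB(1) lev f_eq show ?thesis
    by (auto simp: tree_embeddings_def inj_on_def)
qed

section \<open>Injectivity on objects\<close>

lemma tree_space_inj:
  assumes A: "L_tree A" "pruned A" and B: "L_tree B"
    and levels: "\<And>l::'l. (\<forall>x. l \<le> x) \<or> (\<exists>j k. j < k \<and> k < l)"
    and eq: "tree_space e A = tree_space e B"
  shows "A = B"
proof -
  interpret A: L_tree_loc A by standard fact
  interpret B: L_tree_loc B by standard fact
  have nodes: "nodes A = nodes B"
    using eq by (metis points_tree_space)
  have "(\<lambda>t\<in>nodes A. t) \<in> isometric_embeddings (tree_space e A) (tree_space e B)"
    using nodes by (simp add: isometric_embeddings_def eq)
  then have "(\<lambda>t\<in>nodes A. t) \<in> tree_embeddings A B"
    by (rule isometric_tree_embedding[OF A B levels])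
  then have lev: "\<And>t. t \<in> nodes A \<Longrightarrow> lev B t = lev A t"
    and "\<And>s t. \<lbrakk>s \<in> nodes A; t \<in> nodes A\<rbrakk> \<Longrightarrow> (s, t) \<in> tle A \<longleftrightarrow> (s, t) \<in> tle B"
    by (auto simp: tree_embeddings_def)
  then have "(s, t) \<in> tle A \<longleftrightarrow> (s, t) \<in> tle B" for s t
    using A.tle_nodes[of s t] B.tle_nodes[of s t] nodes by blast
  then have "tle A = tle B"
    by auto
  \<comment> \<open>Off the common node set, both level functions take the default value of
    extensional functions.\<close>
  moreover have "lev A = lev B"
    using lev A(1) B nodes
    by (intro extensionalityI[of _ "nodes A"]) (auto simp: L_tree_def)
  ultimately show ?thesis
    using nodes by simp
qed

end

theorem theorem4p13:
  fixes D :: "real set" and e :: "bool \<times> 'l::linorder \<Rightarrow> real"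
  assumes "countable (UNIV :: 'l set)"
    and "\<not> has_min (UNIV :: 'l set) \<or>
         (\<exists>m::'l. (\<forall>x. m \<le> x) \<and> \<not> has_min (UNIV - {m}))"
    and "D \<subseteq> {0<..}" and "Inf D > 0"
    and "embeds_two_times e D"
  shows "cat_full_embedding (pruned_tree_cat :: (('a, 'l) ltree, 'a \<Rightarrow> 'a) cat)
           (discrete_ultrametric_cat D) (tree_space e) (\<lambda>T T' f. f) \<and>
         (\<forall>T :: ('a, 'l) ltree. L_tree T \<and> pruned T \<longrightarrow>
           uniformly_discrete (tree_space e T) \<and>
           |points (tree_space e T)| =o |nodes T| \<and>
           weight (Metric_space.mtopology (points (tree_space e T)) (dst (tree_space e T)))
             =o |nodes T| )"
proof -
  interpret separated_embedding D e
    using assms(3-5) by unfold_locales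
  have levels: "(\<forall>x. l \<le> x) \<or> (\<exists>j k. j < k \<and> k < l)" for l :: 'l
  proof (cases "has_min (UNIV :: 'l set)")
    case False
    then show ?thesis
      unfolding has_min_def by (metis UNIV_I not_le)
  next
    case True
    then obtain m :: 'l where m: "\<And>x. m \<le> x" "\<not> has_min (UNIV - {m})"
      using assms(2) by blast
    show ?thesis
    proof (cases "l = m")
      case True
      with m(1) show ?thesis by simp
    next
      case False
      \<comment> \<open>\<open>l\<close> is not least among the levels other than \<open>m\<close>;
        the minimum \<open>m\<close> then serves as \<open>j\<close>.\<close>
      then obtain k where "k \<noteq> m" "k < l"
        using m(2) unfolding has_min_def by (auto simp: not_le)
      with m(1)[of k] show ?thesis
        by (metis order.not_eq_order_implies_strict)
    qed
  qed
  have "cat_full_embedding (pruned_tree_cat :: (('a, 'l) ltree, 'a \<Rightarrow> 'a) cat)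
      (discrete_ultrametric_cat D) (tree_space e) (\<lambda>T T' f. f)"
    unfolding cat_full_embedding_def cat_functor_def cat_functor_axioms_def
      cat_full_embedding_axioms_def
    using category_pruned_tree_cat category_discrete_ultrametric_cat
  proof (intro conjI allI impI)
    show "inj_on (tree_space e) (Obj (pruned_tree_cat :: (('a, 'l) ltree, 'a \<Rightarrow> 'a) cat))"
      using tree_space_inj[OF _ _ _ levels] by (auto simp: inj_on_def pruned_tree_cat_def)
  \<comment> \<open>Points are nodes, so identities and composites are the same functions in both
    categories.\<close>
  qed (auto simp: pruned_tree_cat_def discrete_ultrametric_cat_def
      discrete_ultrametric_tree_space tree_embedding_isometric
      intro: isometric_tree_embedding[OF _ _ _ levels])
  then show ?thesis
    by (simp add: uniformly_discrete_tree_space mtopology_tree_space weight_discrete_topology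
        card_of_refl)
qed

end
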